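(* In the standing setting of the context, assume that: (a) for every $w\in(0,\infty)$ the restriction of $\phi$ to $[0,1/w]$ is strongly convex; (b) $\mathcal{S}(\mathring\Theta)=\mathcal{M}\cap(0,1)^m$; (c) $\bar\Theta$ is convex and there exist an $m\times k$ matrix $A$ and $\gamma\in\mathbb{R}^m$ such that $\mathcal{S}(\theta)=A\theta+\gamma$ for all $\theta\in\bar\Theta$; (d) $\lim_{x\to 0^+}\phi'(x)=-\infty$; (e) $\Theta$ is defined by linear inequalities and $\mathcal{M}=\mathcal{S}(\bar\Theta)\subset[0,1]^m$ is a convex subset of probability vectors. Then, for any probability vector $q=(q_1,\dots,q_m)\in(0,1)^m$, the function $\vartheta^*$ is continuously differentiable at $q$ with Jacobian matrix at $q$ given by $$J[\vartheta^*](q)=\left[A^\top\mathrm{diag}\left(\frac{1}{q_1}\phi''\left(\frac{\mathcal{S}_1(\vartheta^*(q))}{q_1}\right),\dots,\frac{1}{q_m}\phi''\left(\frac{\mathcal{S}_m(\vartheta^*(q))}{q_m}\right)\right)A\right]^{-1}A^\top\Delta(q),$$ where $$\Delta(q)=\mathrm{diag}\left(\frac{\mathcal{S}_1(\vartheta^*(q))}{q_1^2}\phi''\left(\frac{\mathcal{S}_1(\vartheta^*(q))}{q_1}\right),\dots,\frac{\mathcal{S}_m(\vartheta^*(q))}{q_m^2}\phi''\left(\frac{\mathcal{S}_m(\vartheta^*(q))}{q_m}\right)\right),$$ and the function $\mathcal{S}^*$ is continuously differentiable at $q$ with Jacobian matrix at $q$ given by $J[\mathcal{S}^*](q)=A\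,J[\vartheta^*](q)$.
   Context: Fix a positive integer $m$. The function $\phi:[0,\infty)\to\mathbb{R}$ is convex and continuous at $0$. Define $f:[0,\infty)^2\to\mathbb{R}\cup\{\infty\}$ by $f(v,w)=w\,\phi(v/w)$ if $v\ge 0$, $w>0$; $f(v,0)=v\lim_{x\to\infty}\phi(x)/x$ if $v>0$ (the limit exists in $\mathbb{R}\cup\{\infty\}$); and $f(0,0)=0$. For $s,t\in[0,\infty)^m$, $D_\phi(s\mid t)=\sum_{i=1}^m f(s_i,t_i)$. A $\phi$-projection of $t$ on a nonempty set $\mathcal{M}$ is an element $s^*\in\mathcal{M}$ with $D_\phi(s^*\mid t)=\inf_{s\in\mathcal{M}}D_\phi(s\mid t)$. A probability vector is an element of $[0,1]^m$ whose components sum to one. Standing assumptions: $\phi$ is strictly convex and twice continuously differentiable on $(0,\infty)$. For some positive integer $k\le m$, $\Theta\subset\mathbb{R}^k$ is bounded, with closure $\bar\Theta$ and nonempty interior $\mathring\Theta$; $\mathcal{S}=(\mathcal{S}_1,\dots,\mathcal{S}_m):\bar\Theta\to[0,1]^m$ is continuous, injective, twice continuously differentiable on $\mathring\Theta$, and satisfies $\mathcal{S}(\mathring\Theta)\subset(0,1)^m$; and $\mathcal{M}=\mathcal{S}(\bar\Theta)$. For $t$ in an open neighborhood (in $\mathbb{R}^m$) of $q$ contained in $(0,1)^m$: $\mathcal{S}^*(t)=\operatorname*{arg\,inf}_{s\in\mathcal{M}}D_\phi(s\mid t)$ is the unique $\phi$-projection of $t$ on $\mathcal{M}$, and $\vartheta^*(t)=\operatorname*{arg\,inf}_{\theta\in\mathring\Theta}D_\phi(\mathcal{S}(\theta)\mid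 t)$ is the unique $\theta\in\mathring\Theta$ with $\mathcal{S}(\theta)=\mathcal{S}^*(t)$ (that these are well defined is part of the assertion). "Defined by linear inequalities" means that $\Theta$ is the set of solutions $\theta\in\mathbb{R}^k$ of a finite system of linear inequalities (with constant terms allowed, i.e. of the form $a^\top\theta\le b$, with $a\in\mathbb{R}^k$, $b\in\mathbb{R}$, possibly strict). A function $H$ from a convex set $\mathcal{Y}\subset\mathbb{R}^d$ to $\mathbb{R}$ is strongly convex if there is a constant $\kappa_H\in(0,\infty)$ such that for all $x,y\in\mathcal{Y}$ and $\alpha\in[0,1]$, $H(\alpha x+(1-\alpha)y)\le \alpha H(x)+(1-\alpha)H(y)-\frac{\kappa_H}{2}\alpha(1-\alpha)\|x-y\|_2^2$. $J[g](y)$ denotes the usual Jacobian matrix of $g$ at $y$. "Continuously differentiable at $q$" means differentiable on an open neighborhood of $q$ in $\mathbb{R}^m$ with Jacobian continuous at $q$. *)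

theory Defs
  imports "HOL-Analysis.Analysis"
begin

definition strictly_convex_on :: "'a::real_vector set \<Rightarrow> ('a \<Rightarrow> real) \<Rightarrow> bool" where
  "strictly_convex_on Y H \<longleftrightarrow> convex Y \<and>
     (\<forall>x\<in>Y. \<forall>y\<in>Y. \<forall>\<alpha>. x \<noteq> y \<longrightarrow> 0 < \<alpha> \<longrightarrow> \<alpha> < 1 \<longrightarrow>
        H (\<alpha> *\<^sub>R x + (1 - \<alpha>) *\<^sub>R y) < \<alpha> * H x + (1 - \<alpha>) * H y)"

definition strongly_convex_on :: "'a::euclidean_space set \<Rightarrow> ('a \<Rightarrow> real) \<Rightarrow> bool" where
  "strongly_convex_on Y H \<longleftrightarrow> convex Y \<and>
     (\<exists>\<kappa>>0. \<forall>x\<in>Y. \<forall>y\<in>Y. \<forall>\<alpha>\<in>{0..1}.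
        H (\<alpha> *\<^sub>R x + (1 - \<alpha>) *\<^sub>R y)
          \<le> \<alpha> * H x + (1 - \<alpha>) * H y - \<kappa> / 2 * \<alpha> * (1 - \<alpha>) * (norm (x - y))\<^sup>2)"

text \<open>Meant for open \<open>U\<close>, where the derivatives are uniquely determined.\<close>

definition twice_continuously_differentiable_on ::
    "('a::real_normed_vector \<Rightarrow> 'b::real_normed_vector) \<Rightarrow> 'a set \<Rightarrow> bool" where
  "twice_continuously_differentiable_on g U \<longleftrightarrow>
     (\<exists>(g' :: 'a \<Rightarrow> 'a \<Rightarrow>\<^sub>L 'b) (g'' :: 'a \<Rightarrow> 'a \<Rightarrow>\<^sub>L 'a \<Rightarrow>\<^sub>L 'b).
        (\<forall>x\<in>U. (g has_derivative blinfun_apply (g' x)) (at x)) \<and>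
        (\<forall>x\<in>U. (g' has_derivative blinfun_apply (g'' x)) (at x)) \<and>
        continuous_on U g'')"

definition continuously_differentiable_at :: "(real^'a \<Rightarrow> real^'b) \<Rightarrow> real^'a \<Rightarrow> bool" where
  "continuously_differentiable_at g x \<longleftrightarrow>
     (\<exists>U. open U \<and> x \<in> U \<and> (\<forall>y\<in>U. g differentiable (at y))) \<and>
     isCont (\<lambda>y. jacobian g (at y)) x"

definition diag :: "real^'n \<Rightarrow> real^'n^'n" where
  "diag v = (\<chi> i j. if i = j then v $ i else 0)"

definition open_unit_cube :: "(real^'n) set" where
  "open_unit_cube = {s. \<forall>i. 0 < s $ i \<and> s $ i < 1}"

definition closed_unit_cube :: "(real^'n) set" where
  "closed_unit_cube = {s. \<forall>i. 0 \<le> s $ i \<and> s $ i \<le> 1}"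

definition prob_vectors :: "(real^'n) set" where
  "prob_vectors = {s \<in> closed_unit_cube. (\<Sum>i\<in>UNIV. s $ i) = 1}"

definition defined_by_linear_inequalities :: "(real^'k) set \<Rightarrow> bool" where
  "defined_by_linear_inequalities X \<longleftrightarrow>
     (\<exists>I J :: ((real^'k) \<times> real) set. finite I \<and> finite J \<and>
        X = {\<theta>. (\<forall>(a, b)\<in>I. a \<bullet> \<theta> \<le> b) \<and> (\<forall>(a, b)\<in>J. a \<bullet> \<theta> < b)})"

text \<open>For \<open>\<phi>\<close> convex on the nonnegative reals, \<open>\<phi> x / x\<close> converges in the extended
  reals as \<open>x\<close> tends to infinity, and the limit is not \<open>-\<infinity>\<close>. Only the values of \<open>\<phi>\<close> on
  the nonnegative reals, and nonnegative arguments \<open>v\<close>, \<open>w\<close>, are meaningful.\<close>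

definition perspective :: "(real \<Rightarrow> real) \<Rightarrow> real \<Rightarrow> real \<Rightarrow> ereal" where
  "perspective \<phi> v w =
     (if w > 0 then ereal (w * \<phi> (v / w))
      else if v > 0 then ereal v * Lim at_top (\<lambda>x. ereal (\<phi> x / x))
      else 0)"

definition phi_divergence :: "(real \<Rightarrow> real) \<Rightarrow> real^'m \<Rightarrow> real^'m \<Rightarrow> ereal" where
  "phi_divergence \<phi> s t = (\<Sum>i\<in>UNIV. perspective \<phi> (s $ i) (t $ i))"

definition attains_inf :: "('a \<Rightarrow> ereal) \<Rightarrow> 'a set \<Rightarrow> 'a \<Rightarrow> bool" where
  "attains_inf g X x \<longleftrightarrow> x \<in> X \<and> g x = (INF y\<in>X. g y)"

definition is_phi_projection :: "(real \<Rightarrow> real) \<Rightarrow> (real^'m) set \<Rightarrow> real^'m \<Rightarrow> real^'m \<Rightarrow> bool" where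
  "is_phi_projection \<phi> M t s \<longleftrightarrow> attains_inf (\<lambda>s. phi_divergence \<phi> s t) M s"

text \<open>The following two functions are meaningful only at those \<open>t\<close> for which the respective
  minimizer exists and is unique.\<close>

definition S_star :: "(real \<Rightarrow> real) \<Rightarrow> (real^'m) set \<Rightarrow> real^'m \<Rightarrow> real^'m" where
  "S_star \<phi> M t = (THE s. is_phi_projection \<phi> M t s)"

definition theta_star ::
    "(real \<Rightarrow> real) \<Rightarrow> (real^'k) set \<Rightarrow> (real^'k \<Rightarrow> real^'m) \<Rightarrow> real^'m \<Rightarrow> real^'k" where
  "theta_star \<phi> \<Theta> S t =
     (THE \<theta>. attains_inf (\<lambda>\<theta>. phi_divergence \<phi> (S \<theta>) t) (interior \<Theta>) \<theta>)"

end

theory Submission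
  imports Defs
begin

text \<open>For \<open>t\<close> in the open cube the divergence is real valued, continuous and, by strong convexity
  of \<open>\<phi>\<close>, strictly midpoint convex in its first argument, so it has a unique minimiser on the
  compact convex set \<open>M\<close>. As \<open>\<phi>'\<close> tends to \<open>-\<infinity>\<close> at zero, that minimiser has positive
  coordinates, hence lies in the image of the interior of \<open>\<Theta>\<close>. The minimiser depends continuously
  on \<open>t\<close> (its graph is closed and \<open>M\<close> is compact), and the parameter satisfies the first-order
  condition \<open>A\<^sup>T (\<phi>' ((A \<theta> + \<gamma>)\<^sub>i / t\<^sub>i))\<^sub>i = 0\<close>. Linearising this equation along the continuous
  solution gives the derivative; the matrix to be inverted is a weighted Gram matrix of
  the injective \<open>A\<close> with positive weights.\<close>

section \<open>Implicit differentiation and continuity of minimisers\<close>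

text \<open>With \<open>g\<close> known to be continuous, the expansion of \<open>F\<close> at the
  single point \<open>(g t, t)\<close> suffices: \<open>L\<close> cancels the first partial
  derivative and leaves the increment of \<open>g\<close> minus its linear prediction, up to an
  error small against the increments of \<open>g\<close> and \<open>t\<close>. The share of
  \<open>g\<close> is then absorbed on the left.\<close>

lemma has_derivative_implicit:
  fixes F :: "'a::real_normed_vector \<times> 'b::real_normed_vector \<Rightarrow> 'c::real_normed_vector"
  assumes F: "(F has_derivative F') (at (g t, t))"
    and g: "isCont g t"
    and zero: "eventually (\<lambda>u. F (g u, u) = 0) (nhds t)"
    and L: "bounded_linear L" "\<And>x. L (F' (x, 0)) = x"
  shows "(g has_derivative (\<lambda>h. - L (F' (0, h)))) (at t)"
proof -
  interpret F': bounded_linear F' using F by (rule has_derivative_bounded_linear)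
  interpret L: bounded_linear L by (rule L)
  define G where "G h = - L (F' (0, h))" for h
  have G: "bounded_linear G"
    unfolding G_def
    by (intro bounded_linear_minus bounded_linear_compose[OF L(1)]
        bounded_linear_compose[OF F'.bounded_linear]
        bounded_linear_Pair bounded_linear_zero bounded_linear_ident)
  obtain C where C: "C > 0" "\<And>h. norm (G h) \<le> norm h * C"
    using bounded_linear.pos_bounded[OF G] by blast
  obtain K where K: "K > 0" "\<And>x. norm (L x) \<le> norm x * K"
    using L.pos_bounded by blast
  have zt: "F (g t, t) = 0" using zero by (rule eventually_nhds_x_imp_x)
  show ?thesis
    unfolding has_derivative_at_alt G_def[symmetric]
  proof (intro conjI allI impI G)
    fix e :: real assume e: "e > 0"
    \<comment> \<open>The first bound gives \<open>K * \<epsilon> \<le> 1/2\<close>, enough to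
      absorb the increment of \<open>g\<close>; the second brings the final error below
      \<open>e\<close> once both increments together are at most \<open>2 * C + 2\<close> times the
      norm of \<open>u - t\<close>.\<close>
    define \<epsilon> where "\<epsilon> = min (1 / (2 * K)) (e / (K * (2 * C + 2)))"
    have eps: "\<epsilon> > 0" "K * \<epsilon> \<le> 1/2" "K * \<epsilon> * (2 * C + 2) \<le> e"
    proof -
      show "\<epsilon> > 0" using e K C by (simp add: \<epsilon>_def)
      have "K * \<epsilon> \<le> K * (1 / (2 * K))"
        using K by (intro mult_left_mono) (auto simp: \<epsilon>_def)
      then show "K * \<epsilon> \<le> 1/2" using K by simp
      have "K * \<epsilon> * (2 * C + 2) \<le> K * (e / (K * (2 * C + 2))) * (2 * C + 2)"
        using K C by (intro mult_left_mono mult_right_mono) (auto simp: \<epsilon>_def)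
      then show "K * \<epsilon> * (2 * C + 2) \<le> e" using K C by simp
    qed
    obtain d where d: "d > 0" "\<And>z. norm (z - (g t, t)) < d \<Longrightarrow>
        norm (F z - F (g t, t) - F' (z - (g t, t))) \<le> \<epsilon> * norm (z - (g t, t))"
      using F eps(1) unfolding has_derivative_at_alt by blast
    have "isCont (\<lambda>u. (g u, u)) t" using g by (intro continuous_intros)
    then have "((\<lambda>u. (g u, u)) \<longlongrightarrow> (g t, t)) (nhds t)"
      using tendsto_at_iff_tendsto_nhds[of "\<lambda>u. (g u, u)" t] by (simp add: isCont_def)
    from tendstoD[OF this d(1)]
    have "eventually (\<lambda>u. norm ((g u, u) - (g t, t)) < d) (nhds t)"
      by (simp add: dist_norm)
    then have "eventually (\<lambda>u. norm ((g u, u) - (g t, t)) < d \<and> F (g u, u) = 0) (nhds t)"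
      using zero by eventually_elim simp
    then obtain r where r: "r > 0" "\<And>u. norm (u - t) < r \<Longrightarrow>
        norm ((g u, u) - (g t, t)) < d \<and> F (g u, u) = 0"
      unfolding eventually_nhds_metric dist_norm by blast
    show "\<exists>d>0. \<forall>y. norm (y - t) < d \<longrightarrow> norm (g y - g t - G (y - t)) \<le> e * norm (y - t)"
    proof (intro exI conjI allI impI)
      show "r > 0" by (rule r)
      fix u assume u: "norm (u - t) < r"
      let ?x = "g u - g t" and ?h = "u - t"
      \<comment> \<open>Splitting the pair into its two components isolates the residual to be
        bounded.\<close>
      have eq: "L (F' (?x, ?h)) = ?x - G ?h"
        using F'.add[of "(?x, 0)" "(0, ?h)"] by (simp add: L.add L(2) G_def)
      \<comment> \<open>\<open>F\<close> vanishes at both points, so the expansion error is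
        \<open>F'\<close> of the increment itself.\<close>
      have "norm (F' (?x, ?h)) \<le> \<epsilon> * norm (?x, ?h)"
        using d(2)[of "(g u, u)"] r(2)[OF u] zt by simp
      also have "\<dots> \<le> \<epsilon> * (norm ?x + norm ?h)"
        using eps(1) norm_Pair_le[of ?x ?h] by (intro mult_left_mono) auto
      finally have "norm (F' (?x, ?h)) * K \<le> \<epsilon> * (norm ?x + norm ?h) * K"
        using K(1) by (intro mult_right_mono) auto
      then have b: "norm (?x - G ?h) \<le> K * \<epsilon> * (norm ?x + norm ?h)"
        using K(2)[of "F' (?x, ?h)"] eq by (simp add: mult_ac)
      also have "\<dots> \<le> 1/2 * (norm ?x + norm ?h)"
        using eps(2) by (intro mult_right_mono) auto
      \<comment> \<open>Half of the norm of \<open>?x\<close> moves to the left-hand side.\<close>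
      finally have "norm ?x \<le> (2 * C + 1) * norm ?h"
        using C(2)[of ?h] norm_triangle_sub[of ?x "G ?h"] by (simp add: algebra_simps)
      then have "norm ?x + norm ?h \<le> (2 * C + 2) * norm ?h"
        by (simp add: algebra_simps)
      then have "K * \<epsilon> * (norm ?x + norm ?h) \<le> K * \<epsilon> * ((2 * C + 2) * norm ?h)"
        using K(1) eps(1) by (intro mult_left_mono) auto
      also have "\<dots> \<le> e * norm ?h"
        using mult_right_mono[OF eps(3), of "norm ?h"] by (simp add: mult.assoc)
      finally show "norm (?x - G ?h) \<le> e * norm ?h" using b by linarith
    qed
  qed
qed

text \<open>Compactness of \<open>K\<close> reduces continuity to a relatively closed graph. Each
  competitor \<open>y\<close> contributes one closed condition, and uniqueness makes the
  intersection over all \<open>y\<close> exactly the graph.\<close>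

lemma continuous_on_unique_argmin:
  fixes E :: "'a::euclidean_space \<times> 'b::euclidean_space \<Rightarrow> real"
  assumes K: "compact K"
    and E: "continuous_on (T \<times> K) E"
    and g: "\<And>t. t \<in> T \<Longrightarrow> g t \<in> K"
    and argmin: "\<And>t x. t \<in> T \<Longrightarrow> x \<in> K \<Longrightarrow> (\<forall>y\<in>K. E (t, x) \<le> E (t, y)) \<longleftrightarrow> x = g t"
  shows "continuous_on T g"
proof (cases "K = {}")
  \<comment> \<open>Without competitors the intersection used below would have no index.\<close>
  case True
  with g have "T = {}" by auto
  then show ?thesis by simp
next
  case False
  have c: "continuous_on (T \<times> K) (\<lambda>z. E z - E (fst z, y))" if "y \<in> K" for y
  proof (rule continuous_on_diff[OF E continuous_on_compose2[OF E]])
    show "continuous_on (T \<times> K) (\<lambda>z. (fst z, y))" by (intro continuous_intros)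
  qed (use that in auto)
  have graph: "(\<lambda>t. (t, g t)) ` T = (\<Inter>y\<in>K. {z \<in> T \<times> K. E z - E (fst z, y) \<le> 0})"
  proof (intro equalityI subsetI)
    fix z assume "z \<in> (\<lambda>t. (t, g t)) ` T"
    then obtain t where t: "t \<in> T" "z = (t, g t)" by blast
    then have "\<forall>y\<in>K. E (t, g t) \<le> E (t, y)" using argmin[OF t(1) g[OF t(1)]] by simp
    with t g[OF t(1)] show "z \<in> (\<Inter>y\<in>K. {z \<in> T \<times> K. E z - E (fst z, y) \<le> 0})"
      by simp
  next
    fix z assume "z \<in> (\<Inter>y\<in>K. {z \<in> T \<times> K. E z - E (fst z, y) \<le> 0})"
    then have "fst z \<in> T" "snd z \<in> K" "\<forall>y\<in>K. E (fst z, snd z) \<le> E (fst z, y)"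
      using False by auto
    then show "z \<in> (\<lambda>t. (t, g t)) ` T"
      using argmin[of "fst z" "snd z"] by (cases z) (simp add: image_iff)
  qed
  have closed: "closedin (top_of_set (T \<times> K)) (\<Inter>y\<in>K. {z \<in> T \<times> K. E z - E (fst z, y) \<le> 0})"
  proof (intro closedin_INT False)
    fix y assume "y \<in> K"
    from continuous_closedin_preimage[OF c[OF this] closed_atMost, of 0]
    show "closedin (top_of_set (T \<times> K)) {z \<in> T \<times> K. E z - E (fst z, y) \<le> 0}"
      by (simp add: vimage_def Int_def)
  qed
  have gT: "g \<in> T \<rightarrow> K" using g by (rule Pi_I)
  show ?thesis
    unfolding continuous_closed_graph_eq[OF K gT] graph by (rule closed)
qed

section \<open>Continuity of solutions of linear systems\<close>

lemma continuous_on_det: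
  fixes A :: "'a::topological_space \<Rightarrow> real^'n^'n"
  assumes "\<And>i j. continuous_on S (\<lambda>x. A x $ i $ j)"
  shows "continuous_on S (\<lambda>x. det (A x))"
  unfolding det_def by (intro continuous_intros assms)

text \<open>Cramer's rule, applied column by column, writes each entry of the solution as a quotient
  of determinants, which are polynomial in the entries. This serves for the Jacobian, whose formula
  contains a matrix inverse.\<close>

lemma continuous_on_matrix_solution:
  fixes B :: "'a::topological_space \<Rightarrow> real^'n^'n" and X N :: "'a \<Rightarrow> real^'p^'n"
  assumes B: "\<And>i j. continuous_on S (\<lambda>x. B x $ i $ j)"
    and N: "\<And>i j. continuous_on S (\<lambda>x. N x $ i $ j)"
    and det: "\<And>x. x \<in> S \<Longrightarrow> det (B x) \<noteq> 0"
    and eq: "\<And>x. x \<in> S \<Longrightarrow> B x ** X x = N x"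
  shows "continuous_on S X"
proof -
  have "X x $ k $ j = det (\<chi> i l. if l = k then N x $ i $ j else B x $ i $ l) / det (B x)"
    if "x \<in> S" for x k j
  proof -
    have "B x *v column j (X x) = column j (N x)"
      using eq[OF that]
      by (auto simp: vec_eq_iff column_def matrix_vector_mult_def matrix_matrix_mult_def)
    then have "column j (X x) =
        (\<chi> k. det (\<chi> i l. if l = k then column j (N x) $ i else B x $ i $ l) / det (B x))"
      using cramer[OF det[OF that]] by blast
    from arg_cong[where f = "\<lambda>v. v $ k", OF this] show ?thesis
      by (simp add: column_def cong: if_cong)
  qed
  then have "continuous_on S X \<longleftrightarrow> continuous_on S (\<lambda>x. \<chi> k j.
      det (\<chi> i l. if l = k then N x $ i $ j else B x $ i $ l) / det (B x))"
    by (intro continuous_on_cong) (auto simp: vec_eq_iff)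
  moreover have "continuous_on S (\<lambda>x. if l = k then N x $ i $ j else B x $ i $ l)" for i j k l
    using B N by (cases "l = k") auto
  ultimately show ?thesis
    using det by (auto intro!: continuous_intros continuous_on_det B)
qed

lemma has_derivative_vecI:
  fixes f :: "'a::real_normed_vector \<Rightarrow> real^'n"
  assumes "\<And>i. ((\<lambda>x. f x $ i) has_derivative (\<lambda>h. f' h $ i)) (at x)"
  shows "(f has_derivative f') (at x)"
  using assms
  by (subst has_derivative_componentwise_within) (auto simp: Basis_vec_def inner_axis)

section \<open>Second derivatives of functions of one real variable\<close>

text \<open>A bounded linear map on the reals is multiplication by its value at 1, so evaluating the
  operator-valued derivatives at 1 turns them into \<open>deriv\<close>. Openness of
  \<open>U\<close> lets the identity for the first derivative be differentiated.\<close>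

lemma twice_continuously_differentiable_on_real:
  fixes f :: "real \<Rightarrow> real"
  assumes f: "twice_continuously_differentiable_on f U" and U: "open U"
  shows "x \<in> U \<Longrightarrow> (f has_real_derivative deriv f x) (at x)"
    and "x \<in> U \<Longrightarrow> (deriv f has_real_derivative deriv (deriv f) x) (at x)"
    and "continuous_on U (deriv (deriv f))"
proof -
  obtain g' :: "real \<Rightarrow> real \<Rightarrow>\<^sub>L real" and g'' :: "real \<Rightarrow> real \<Rightarrow>\<^sub>L real \<Rightarrow>\<^sub>L real"
    where g': "\<And>x. x \<in> U \<Longrightarrow> (f has_derivative blinfun_apply (g' x)) (at x)"
      and g'': "\<And>x. x \<in> U \<Longrightarrow> (g' has_derivative blinfun_apply (g'' x)) (at x)"
      and cont: "continuous_on U g''"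
    using f unfolding twice_continuously_differentiable_on_def by blast
  have lin: "blinfun_apply l h = blinfun_apply l 1 * h" for l :: "real \<Rightarrow>\<^sub>L real" and h
    using blinfun.scaleR_right[of l h 1] by (simp add: mult.commute)
  have 1: "(f has_real_derivative blinfun_apply (g' x) 1) (at x)" if "x \<in> U" for x
  proof -
    have "blinfun_apply (g' x) = (*) (blinfun_apply (g' x) 1)" by (rule ext) (rule lin)
    with g'[OF that] show ?thesis by (simp add: has_field_derivative_def)
  qed
  then have eq: "deriv f x = blinfun_apply (g' x) 1" if "x \<in> U" for x
    using that DERIV_imp_deriv by blast
  then show "(f has_real_derivative deriv f x) (at x)" if "x \<in> U" for x
    using that 1 by simp
  have 2: "(deriv f has_real_derivative blinfun_apply (blinfun_apply (g'' x) 1) 1) (at x)"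
    if "x \<in> U" for x
  proof -
    have "((\<lambda>x. blinfun_apply (g' x) 1) has_derivative (\<lambda>h. blinfun_apply (blinfun_apply (g'' x) h) 1)) (at x)"
      by (rule bounded_linear.has_derivative[OF blinfun.bounded_linear_left g''[OF that]])
    moreover have "(\<lambda>h. blinfun_apply (blinfun_apply (g'' x) h) 1) =
        (*) (blinfun_apply (blinfun_apply (g'' x) 1) 1)"
    proof
      fix h
      show "blinfun_apply (blinfun_apply (g'' x) h) 1 =
          blinfun_apply (blinfun_apply (g'' x) 1) 1 * h"
        using blinfun.scaleR_right[of "g'' x" h 1] by (simp add: blinfun.scaleR_left mult.commute)
    qed
    ultimately have "((\<lambda>x. blinfun_apply (g' x) 1) has_real_derivative
        blinfun_apply (blinfun_apply (g'' x) 1) 1) (at x)"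
      by (simp add: has_field_derivative_def)
    then show ?thesis
      by (rule has_field_derivative_transform_within_open[OF _ U that]) (simp add: eq)
  qed
  then have eq2: "deriv (deriv f) x = blinfun_apply (blinfun_apply (g'' x) 1) 1" if "x \<in> U" for x
    using that DERIV_imp_deriv by blast
  then show "(deriv f has_real_derivative deriv (deriv f) x) (at x)" if "x \<in> U" for x
    using that 2 by simp
  have "continuous_on U (\<lambda>x. blinfun_apply (blinfun_apply (g'' x) 1) 1)"
    by (intro continuous_intros cont)
  then show "continuous_on U (deriv (deriv f))"
    by (rule continuous_on_eq) (simp add: eq2)
qed

text \<open>Subtracting \<open>\<kappa> / 2 * x\<^sup>2\<close> leaves a convex function. Its
  tangent inequalities at two points force the difference quotients of \<open>f'\<close> to be at
  least \<open>\<kappa>\<close>, and the bound survives the limit.\<close>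

lemma strongly_convex_on_deriv2_pos:
  fixes f :: "real \<Rightarrow> real"
  assumes f: "strongly_convex_on S f" and U: "open U" "U \<subseteq> S" "x \<in> U"
    and d1: "\<And>y. y \<in> U \<Longrightarrow> (f has_real_derivative f' y) (at y)"
    and d2: "(f' has_real_derivative f'') (at x)"
  shows "f'' > 0"
proof -
  obtain \<kappa> where \<kappa>: "\<kappa> > 0" and conv: "\<And>x y \<alpha>. x \<in> S \<Longrightarrow> y \<in> S \<Longrightarrow> \<alpha> \<in> {0..1} \<Longrightarrow>
      f (\<alpha> *\<^sub>R x + (1 - \<alpha>) *\<^sub>R y) \<le> \<alpha> * f x + (1 - \<alpha>) * f y - \<kappa> / 2 * \<alpha> * (1 - \<alpha>) * (norm (x - y))\<^sup>2"
    and S: "convex S"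
    using f unfolding strongly_convex_on_def by blast
  let ?H = "\<lambda>x. f x - \<kappa> / 2 * x\<^sup>2"
  have H: "convex_on S ?H"
  proof (rule convex_onI)
    fix \<alpha> x y :: real assume a: "0 < \<alpha>" "\<alpha> < 1" and xy: "x \<in> S" "y \<in> S"
    have "f ((1 - \<alpha>) *\<^sub>R x + \<alpha> *\<^sub>R y) \<le> (1 - \<alpha>) * f x + \<alpha> * f y - \<kappa> / 2 * (1 - \<alpha>) * \<alpha> * (x - y)\<^sup>2"
      using conv[of x y "1 - \<alpha>"] a xy by simp
    \<comment> \<open>The strong convexity gap is exactly the convexity gap of the subtracted
      square.\<close>
    also have "\<dots> = (1 - \<alpha>) * ?H x + \<alpha> * ?H y + \<kappa> / 2 * ((1 - \<alpha>) *\<^sub>R x + \<alpha> *\<^sub>R y)\<^sup>2"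
      by (simp add: algebra_simps power2_eq_square add_divide_distrib diff_divide_distrib)
    finally show "?H ((1 - \<alpha>) *\<^sub>R x + \<alpha> *\<^sub>R y) \<le> (1 - \<alpha>) * ?H x + \<alpha> * ?H y" by simp
  qed (rule S)
  have tangent: "?H z - ?H y \<ge> (f' y - \<kappa> * y) * (z - y)" if "y \<in> U" "z \<in> U" for y z
  proof (rule convex_on_imp_above_tangent[OF H])
    show "connected S" using S by (rule convex_connected)
    show "y \<in> interior S" using U(1,2) that(1) by (meson interior_maximal subsetD)
    show "z \<in> S" using U that by auto
    show "(?H has_real_derivative f' y - \<kappa> * y) (at y within S)"
      by (auto intro!: derivative_eq_intros has_field_derivative_at_within[OF d1[OF that(1)]])
  qed
  have "eventually (\<lambda>y. y \<in> U) (at x)"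
    using U by (meson eventually_at_topological)
  then have "eventually (\<lambda>y. \<kappa> \<le> (f' y - f' x) / (y - x)) (at x)"
    using eventually_at_filter[of "\<lambda>y. y \<noteq> x" x UNIV, simplified]
  proof (eventually_elim)
    case (elim y)
    \<comment> \<open>The tangent inequalities at \<open>x\<close> and at \<open>y\<close> are
      added; keeping the square as a factor avoids cases on the sign of
      \<open>y - x\<close>.\<close>
    have "\<kappa> * (y - x)\<^sup>2 \<le> (f' y - f' x) * (y - x)"
      using tangent[of x y] tangent[of y x] elim U(3) by (simp add: algebra_simps power2_eq_square)
    also have "\<dots> = (f' y - f' x) / (y - x) * (y - x)\<^sup>2"
      using elim by (simp add: power2_eq_square)
    finally have "\<kappa> * (y - x)\<^sup>2 \<le> (f' y - f' x) / (y - x) * (y - x)\<^sup>2" .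
    then show ?case
      by (rule mult_right_le_imp_le) (use elim in simp)
  qed
  then have "\<kappa> \<le> f''"
    using d2 unfolding has_field_derivative_iff
    by (intro tendsto_lowerbound) auto
  then show ?thesis using \<kappa> by simp
qed

section \<open>Minimisers, Jacobians and weighted Gram matrices\<close>

lemma attains_inf_iff: "attains_inf g X x \<longleftrightarrow> x \<in> X \<and> (\<forall>y\<in>X. g x \<le> g y)"
  unfolding attains_inf_def by (metis INF_greatest INF_lower order_antisym)

lemma matrix_inv_mult:
  fixes A :: "'a::semiring_1^'n^'m"
  assumes "invertible A"
  shows "A ** matrix_inv A = mat 1" and "matrix_inv A ** A = mat 1"
  using someI_ex[OF assms[unfolded invertible_def]] by (auto simp: matrix_inv_def)

lemma jacobian_eqI:
  fixes J :: "real^'n^'m"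
  shows "(f has_derivative (\<lambda>h. J *v h)) (at x) \<Longrightarrow> jacobian f (at x) = J"
  by (simp add: jacobian_def frechet_derivative_at[symmetric] matrix_def
      matrix_vector_mult_basis column_def vec_eq_iff)

lemma diag_mult_vec: "diag v *v x = (\<chi> i. v $ i * x $ i)"
  by (simp add: diag_def matrix_vector_mult_def vec_eq_iff if_distrib[of "\<lambda>c. c * _"] cong: if_cong)

text \<open>Pairing a kernel vector \<open>v\<close> with its image gives the weighted sum of
  squares of the entries of \<open>A *v v\<close>, so positive weights force
  \<open>A *v v = 0\<close>; a square matrix with trivial kernel is invertible.\<close>

lemma invertible_weighted_gram:
  fixes A :: "real^'k^'m"
  assumes A: "\<And>v. A *v v = 0 \<Longrightarrow> v = 0" and d: "\<And>i. d $ i > 0"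
  shows "invertible (transpose A ** diag d ** A)"
proof -
  have "v = 0" if "(transpose A ** diag d ** A) *v v = 0" for v
  proof -
    let ?w = "A *v v"
    have "0 = v \<bullet> (transpose A *v (diag d *v ?w))"
      using that by (simp add: matrix_vector_mul_assoc matrix_mul_assoc)
    also have "\<dots> = (diag d *v ?w) \<bullet> ?w"
      by (metis dot_lmul_matrix inner_commute transpose_matrix_vector)
    also have "\<dots> = (\<Sum>i\<in>UNIV. d $ i * (?w $ i)\<^sup>2)"
      by (simp add: diag_mult_vec inner_vec_def power2_eq_square mult.assoc)
    finally have "(\<Sum>i\<in>UNIV. d $ i * (?w $ i)\<^sup>2) = 0" by simp
    then have "\<forall>i\<in>UNIV. d $ i * (?w $ i)\<^sup>2 = 0"
      by (subst (asm) sum_nonneg_eq_0_iff) (auto intro!: mult_nonneg_nonneg less_imp_le[OF d])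
    then have "?w = 0" using d by (auto simp: vec_eq_iff less_le)
    then show ?thesis by (rule A)
  qed
  then show ?thesis
    by (simp add: invertible_left_inverse matrix_left_invertible_ker)
qed

section \<open>The divergence as a real function: continuity, convexity, boundary behaviour\<close>

text \<open>Real-valued form of the divergence for \<open>t\<close> with all coordinates positive,
  where the limit branch of \<open>perspective\<close> never occurs.\<close>

definition phi_sum :: "(real \<Rightarrow> real) \<Rightarrow> real^'m \<Rightarrow> real^'m \<Rightarrow> real" where
  "phi_sum \<phi> s t = (\<Sum>i\<in>UNIV. t $ i * \<phi> (s $ i / t $ i))"

lemma phi_divergence_eq:
  "t \<in> open_unit_cube \<Longrightarrow> phi_divergence \<phi> s t = ereal (phi_sum \<phi> s t)"
  by (simp add: phi_divergence_def phi_sum_def perspective_def open_unit_cube_def)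

lemma open_open_unit_cube: "open (open_unit_cube :: (real^'n) set)"
  unfolding open_unit_cube_def Collect_all_eq
  by (intro open_INT ballI finite open_Collect_conj open_Collect_less continuous_intros)

lemma continuous_on_phi_sum:
  assumes \<phi>: "continuous_on {0..} \<phi>"
  shows "continuous_on (open_unit_cube \<times> closed_unit_cube) (\<lambda>(t, s). phi_sum \<phi> s t)"
proof -
  have "continuous_on (open_unit_cube \<times> closed_unit_cube) (\<lambda>z. \<phi> (snd z $ i / fst z $ i))" for i
    by (rule continuous_on_compose2[OF \<phi>], intro continuous_intros)
      (auto simp: open_unit_cube_def closed_unit_cube_def less_imp_neq less_imp_le
        intro!: divide_nonneg_pos dest: spec[of _ i])
  then show ?thesis
    unfolding phi_sum_def case_prod_unfold by (intro continuous_intros)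
qed

text \<open>The source of uniqueness. The ratios lie in \<open>{0..1 / t $ i}\<close>, so strong
  convexity is available with \<open>w = t $ i\<close>. Every coordinate satisfies the weak
  inequality, and one where \<open>s\<close> and \<open>s'\<close> differ supplies the strict
  gap.\<close>

lemma phi_sum_midpoint_less:
  assumes \<phi>: "\<And>w. w > 0 \<Longrightarrow> strongly_convex_on {0..1 / w} \<phi>"
    and t: "t \<in> open_unit_cube" and s: "s \<in> closed_unit_cube" "s' \<in> closed_unit_cube" "s \<noteq> s'"
  shows "phi_sum \<phi> ((1/2) *\<^sub>R s + (1/2) *\<^sub>R s') t < (phi_sum \<phi> s t + phi_sum \<phi> s' t) / 2"
proof -
  have tpos: "t $ i > 0" for i using t by (simp add: open_unit_cube_def)
  let ?d = "\<lambda>i. s $ i / t $ i - s' $ i / t $ i"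
  have "\<exists>\<kappa>>0. \<phi> (((1/2) *\<^sub>R s + (1/2) *\<^sub>R s') $ i / t $ i)
      \<le> (\<phi> (s $ i / t $ i) + \<phi> (s' $ i / t $ i)) / 2 - \<kappa> * (?d i)\<^sup>2" for i
  proof -
    from \<phi>[OF tpos[of i]] obtain \<kappa> where "\<kappa> > 0" and
      \<kappa>: "\<And>x y \<alpha>. x \<in> {0..1 / t $ i} \<Longrightarrow> y \<in> {0..1 / t $ i} \<Longrightarrow> \<alpha> \<in> {0..1} \<Longrightarrow>
        \<phi> (\<alpha> *\<^sub>R x + (1 - \<alpha>) *\<^sub>R y) \<le> \<alpha> * \<phi> x + (1 - \<alpha>) * \<phi> y - \<kappa> / 2 * \<alpha> * (1 - \<alpha>) * (norm (x - y))\<^sup>2"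
      unfolding strongly_convex_on_def by blast
    have "s $ i / t $ i \<in> {0..1 / t $ i}" "s' $ i / t $ i \<in> {0..1 / t $ i}"
      using s tpos[of i] by (auto simp: closed_unit_cube_def divide_right_mono)
    \<comment> \<open>The constant \<open>\<kappa> / 8\<close> is \<open>\<kappa> / 2\<close> times
      the product of the two weights 1/2.\<close>
    from \<kappa>[OF this, of "1/2"] have "\<phi> (((1/2) *\<^sub>R s + (1/2) *\<^sub>R s') $ i / t $ i)
      \<le> (\<phi> (s $ i / t $ i) + \<phi> (s' $ i / t $ i)) / 2 - \<kappa> / 8 * (?d i)\<^sup>2"
      by (simp add: add_divide_distrib)
    then show ?thesis using \<open>\<kappa> > 0\<close> by (intro exI[of _ "\<kappa> / 8"]) simp
  qed
  then obtain \<kappa> where \<kappa>: "\<And>i. \<kappa> i > 0" "\<And>i. \<phi> (((1/2) *\<^sub>R s + (1/2) *\<^sub>R s') $ i / t $ i)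
      \<le> (\<phi> (s $ i / t $ i) + \<phi> (s' $ i / t $ i)) / 2 - \<kappa> i * (?d i)\<^sup>2"
    by metis
  obtain j where j: "s $ j \<noteq> s' $ j" using s(3) by (auto simp: vec_eq_iff)
  have "phi_sum \<phi> ((1/2) *\<^sub>R s + (1/2) *\<^sub>R s') t
      < (\<Sum>i\<in>UNIV. t $ i * ((\<phi> (s $ i / t $ i) + \<phi> (s' $ i / t $ i)) / 2))"
    unfolding phi_sum_def
  proof (rule sum_strict_mono_ex1)
    show "\<forall>i\<in>UNIV. t $ i * \<phi> (((1/2) *\<^sub>R s + (1/2) *\<^sub>R s') $ i / t $ i)
        \<le> t $ i * ((\<phi> (s $ i / t $ i) + \<phi> (s' $ i / t $ i)) / 2)"
    proof
      fix i
      have "\<kappa> i * (?d i)\<^sup>2 \<ge> 0" using \<kappa>(1)[of i] by simp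
      with \<kappa>(2)[of i] show "t $ i * \<phi> (((1/2) *\<^sub>R s + (1/2) *\<^sub>R s') $ i / t $ i)
        \<le> t $ i * ((\<phi> (s $ i / t $ i) + \<phi> (s' $ i / t $ i)) / 2)"
        using tpos[of i] by (intro mult_left_mono) linarith+
    qed
    have "?d j \<noteq> 0" using j tpos[of j] by simp
    then have "\<kappa> j * (?d j)\<^sup>2 > 0" using \<kappa>(1)[of j] by simp
    with \<kappa>(2)[of j] show "\<exists>i\<in>UNIV. t $ i * \<phi> (((1/2) *\<^sub>R s + (1/2) *\<^sub>R s') $ i / t $ i)
        < t $ i * ((\<phi> (s $ i / t $ i) + \<phi> (s' $ i / t $ i)) / 2)"
      using tpos[of j] by (intro bexI[where x = j] UNIV_I mult_strict_left_mono) linarith+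
  qed simp
  then show ?thesis
    by (simp add: phi_sum_def sum.distrib sum_divide_distrib add_divide_distrib distrib_left)
qed

text \<open>Moving from \<open>s\<close> towards \<open>s0\<close> by \<open>\<epsilon>\<close> increases every other term by at most \<open>O(\<epsilon>)\<close>, by
  convexity, while the vanishing coordinate contributes at most \<open>\<epsilon> b \<phi>' (\<epsilon> b)\<close>, where
  \<open>\<phi>' (\<epsilon> b) \<rightarrow> -\<infinity>\<close>.\<close>

lemma phi_sum_less_from_boundary:
  assumes conv: "convex_on {0..} \<phi>"
    and d1: "\<And>x. x > 0 \<Longrightarrow> (\<phi> has_real_derivative deriv \<phi> x) (at x)"
    and steep: "filterlim (deriv \<phi>) at_bot (at_right 0)"
    and t: "\<And>j. t $ j > 0" and s: "\<And>j. s $ j \<ge> 0" "s $ i = 0"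
    and s0: "\<And>j. s0 $ j > 0"
  shows "\<exists>\<epsilon>. 0 < \<epsilon> \<and> \<epsilon> < 1 \<and> phi_sum \<phi> ((1 - \<epsilon>) *\<^sub>R s + \<epsilon> *\<^sub>R s0) t < phi_sum \<phi> s t"
proof -
  define b where "b = s0 $ i / t $ i"
  have b: "b > 0" using s0 t by (simp add: b_def)
  define C where "C = (\<Sum>j\<in>UNIV - {i}. t $ j * (\<phi> (s0 $ j / t $ j) - \<phi> (s $ j / t $ j)))"
  \<comment> \<open>Below this slope the decrease in coordinate \<open>i\<close> outweighs
    \<open>C\<close>, the chord slope of all other terms together.\<close>
  have "eventually (\<lambda>x. deriv \<phi> x < - C / (t $ i * b)) (at_right 0)"
    using steep by (simp add: filterlim_at_bot_dense)
  then obtain \<delta> where \<delta>: "\<delta> > 0" "\<And>x. 0 < x \<Longrightarrow> x < \<delta> \<Longrightarrow> deriv \<phi> x < - C / (t $ i * b)"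
    unfolding eventually_at_right_field by auto
  \<comment> \<open>The bound 1/2 keeps the new point a proper convex combination; the other bound,
    with its factor 2, puts \<open>\<epsilon> * b\<close> strictly below
    \<open>\<delta>\<close>.\<close>
  define \<epsilon> where "\<epsilon> = min (1/2) (\<delta> / (2 * b))"
  have \<epsilon>: "0 < \<epsilon>" "\<epsilon> < 1" using \<delta>(1) b by (auto simp: \<epsilon>_def)
  have "\<epsilon> * b \<le> \<delta> / (2 * b) * b" using b by (intro mult_right_mono) (auto simp: \<epsilon>_def)
  also have "\<dots> < \<delta>" using b \<delta>(1) by simp
  finally have lt: "deriv \<phi> (\<epsilon> * b) < - C / (t $ i * b)"
    using \<delta>(2) \<epsilon> b by simp
  have neg: "\<epsilon> * C + t $ i * (\<epsilon> * b * deriv \<phi> (\<epsilon> * b)) < 0"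
  proof -
    from lt have "t $ i * b * deriv \<phi> (\<epsilon> * b) < - C"
      using b t[of i] by (subst (asm) pos_less_divide_eq) (auto simp: mult_ac)
    then have "\<epsilon> * (t $ i * b * deriv \<phi> (\<epsilon> * b)) < \<epsilon> * (- C)"
      using \<epsilon>(1) by (rule mult_strict_left_mono)
    then show ?thesis by (simp add: algebra_simps)
  qed
  let ?s = "(1 - \<epsilon>) *\<^sub>R s + \<epsilon> *\<^sub>R s0"
  let ?D = "\<lambda>j. t $ j * (\<phi> (?s $ j / t $ j) - \<phi> (s $ j / t $ j))"
  have "?D j \<le> \<epsilon> * (t $ j * (\<phi> (s0 $ j / t $ j) - \<phi> (s $ j / t $ j)))" for j
  proof -
    have "\<phi> ((1 - \<epsilon>) *\<^sub>R (s $ j / t $ j) + \<epsilon> *\<^sub>R (s0 $ j / t $ j))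
        \<le> (1 - \<epsilon>) * \<phi> (s $ j / t $ j) + \<epsilon> * \<phi> (s0 $ j / t $ j)"
      using \<epsilon> s s0 t by (intro convex_onD[OF conv]) (auto simp: less_imp_le)
    moreover have "(1 - \<epsilon>) *\<^sub>R (s $ j / t $ j) + \<epsilon> *\<^sub>R (s0 $ j / t $ j) = ?s $ j / t $ j"
      by (simp add: add_divide_distrib)
    ultimately have "\<phi> (?s $ j / t $ j) - \<phi> (s $ j / t $ j)
        \<le> \<epsilon> * (\<phi> (s0 $ j / t $ j) - \<phi> (s $ j / t $ j))"
      by (simp add: left_diff_distrib right_diff_distrib)
    then have "?D j \<le> t $ j * (\<epsilon> * (\<phi> (s0 $ j / t $ j) - \<phi> (s $ j / t $ j)))"
      using t[of j] by (intro mult_left_mono) auto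
    then show ?thesis by (simp add: mult_ac)
  qed
  then have "(\<Sum>j\<in>UNIV - {i}. ?D j) \<le> \<epsilon> * C"
    unfolding C_def sum_distrib_left by (rule sum_mono)
  moreover have "?D i \<le> t $ i * (\<epsilon> * b * deriv \<phi> (\<epsilon> * b))"
  proof -
    have pos: "\<epsilon> * b > 0" using \<epsilon> b by simp
    \<comment> \<open>The tangent is taken at \<open>\<epsilon> * b\<close>, where
      \<open>\<phi>\<close> is differentiable, and evaluated at the endpoint 0.\<close>
    have "\<phi> 0 - \<phi> (\<epsilon> * b) \<ge> deriv \<phi> (\<epsilon> * b) * (0 - \<epsilon> * b)"
      by (rule convex_on_imp_above_tangent[OF conv])
        (use pos d1[OF pos] in \<open>auto intro: has_field_derivative_at_within\<close>)
    then have "\<phi> (\<epsilon> * b) - \<phi> 0 \<le> \<epsilon> * b * deriv \<phi> (\<epsilon> * b)" by (simp add: mult.commute)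
    then show ?thesis
      using t[of i] s(2) by (intro mult_left_mono) (auto simp: b_def)
  qed
  ultimately have "(\<Sum>j\<in>UNIV. ?D j) < 0"
    using neg by (simp add: sum.remove[of UNIV i])
  then have "phi_sum \<phi> ?s t < phi_sum \<phi> s t"
    by (simp add: phi_sum_def right_diff_distrib sum_subtractf)
  with \<epsilon> show ?thesis by blast
qed

section \<open>The first-order condition and its linearisation\<close>

text \<open>The weight \<open>t $ i\<close> cancels the \<open>1 / t $ i\<close> of the chain rule,
  so the gradient is \<open>transpose A\<close> applied to the vector of \<open>\<phi>'\<close> at
  the ratios.\<close>

lemma has_derivative_phi_sum_affine:
  fixes A :: "real^'k^'m"
  assumes d1: "\<And>x. x > 0 \<Longrightarrow> (\<phi> has_real_derivative \<phi>' x) (at x)"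
    and t: "\<And>i. t $ i > 0" and s: "\<And>i. (A *v \<theta> + \<gamma>) $ i > 0"
  shows "((\<lambda>\<theta>. phi_sum \<phi> (A *v \<theta> + \<gamma>) t) has_derivative
      (\<lambda>h. (transpose A *v (\<chi> i. \<phi>' ((A *v \<theta> + \<gamma>) $ i / t $ i))) \<bullet> h)) (at \<theta>)"
proof -
  have lin: "((\<lambda>\<theta>. (A *v \<theta> + \<gamma>) $ i / t $ i) has_derivative (\<lambda>h. (A *v h) $ i / t $ i)) (at \<theta>)" for i
    using t[of i] by (auto intro!: derivative_eq_intros bounded_linear_imp_has_derivative
        bounded_linear_vec_nth bounded_linear_compose[OF bounded_linear_vec_nth])
  have "((\<lambda>\<theta>. \<phi> ((A *v \<theta> + \<gamma>) $ i / t $ i)) has_derivative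
      (\<lambda>h. \<phi>' ((A *v \<theta> + \<gamma>) $ i / t $ i) * ((A *v h) $ i / t $ i))) (at \<theta>)" for i
    using has_derivative_compose[OF lin d1[unfolded has_field_derivative_def]] s[of i] t[of i] by simp
  then have "((\<lambda>\<theta>. phi_sum \<phi> (A *v \<theta> + \<gamma>) t) has_derivative
      (\<lambda>h. \<Sum>i\<in>UNIV. t $ i * (\<phi>' ((A *v \<theta> + \<gamma>) $ i / t $ i) * ((A *v h) $ i / t $ i)))) (at \<theta>)"
    unfolding phi_sum_def by (intro has_derivative_sum has_derivative_mult_right)
  moreover have "(\<Sum>i\<in>UNIV. t $ i * (\<phi>' ((A *v \<theta> + \<gamma>) $ i / t $ i) * ((A *v h) $ i / t $ i)))
      = (transpose A *v (\<chi> i. \<phi>' ((A *v \<theta> + \<gamma>) $ i / t $ i))) \<bullet> h" for h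
    unfolding transpose_matrix_vector dot_lmul_matrix
    using t[THEN less_imp_neq] by (auto simp: inner_vec_def intro!: sum.cong)
  ultimately show ?thesis by simp
qed

text \<open>The gradient above is differentiated jointly in the parameter and in \<open>t\<close>.
  By the quotient rule each ratio varies by \<open>1 / t $ i\<close> times the change of its
  numerator minus \<open>s $ i / (t $ i)\<^sup>2\<close> times the change of \<open>t $ i\<close>;
  the two coefficients produce the two diagonal matrices.\<close>

lemma has_derivative_score:
  fixes A :: "real^'k^'m" and \<theta> :: "real^'k" and \<gamma> t :: "real^'m"
  defines "s \<equiv> A *v \<theta> + \<gamma>"
  assumes d2: "\<And>x. x > 0 \<Longrightarrow> (\<phi>' has_real_derivative \<phi>'' x) (at x)"
    and t: "\<And>i. t $ i > 0" and s: "\<And>i. s $ i > 0"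
  shows "((\<lambda>z. transpose A *v (\<chi> i. \<phi>' ((A *v fst z + \<gamma>) $ i / snd z $ i))) has_derivative
      (\<lambda>h. (transpose A ** diag (\<chi> i. 1 / t $ i * \<phi>'' (s $ i / t $ i)) ** A) *v fst h
         - (transpose A ** diag (\<chi> i. s $ i / (t $ i)\<^sup>2 * \<phi>'' (s $ i / t $ i))) *v snd h)) (at (\<theta>, t))"
proof -
  have lin: "((\<lambda>z. (A *v fst z + \<gamma>) $ i) has_derivative (\<lambda>h. (A *v fst h) $ i)) (at (\<theta>, t))"
    "((\<lambda>z. snd z $ i) has_derivative (\<lambda>h. snd h $ i)) (at (\<theta>, t))" for i
    by (auto intro!: derivative_eq_intros bounded_linear_imp_has_derivative
        bounded_linear_compose[OF bounded_linear_vec_nth]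
        bounded_linear_compose[OF matrix_vector_mul_bounded_linear] bounded_linear_fst bounded_linear_snd)
  let ?f' = "\<lambda>h i. 1 / t $ i * \<phi>'' (s $ i / t $ i) * (A *v fst h) $ i
      - s $ i / (t $ i)\<^sup>2 * \<phi>'' (s $ i / t $ i) * snd h $ i"
  have div: "((\<lambda>z. (A *v fst z + \<gamma>) $ i / snd z $ i) has_derivative
      (\<lambda>h. - s $ i * (inverse (t $ i) * snd h $ i * inverse (t $ i)) + (A *v fst h) $ i / t $ i)) (at (\<theta>, t))" for i
    using has_derivative_divide[OF lin(1)[of i] lin(2)[of i]] t[of i] by (simp add: s_def)
  have "((\<lambda>z. \<phi>' ((A *v fst z + \<gamma>) $ i / snd z $ i)) has_derivative (\<lambda>h. ?f' h i)) (at (\<theta>, t))" for i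
  proof -
    have "(\<phi>' has_derivative (*) (\<phi>'' (s $ i / t $ i)))
        (at ((A *v fst (\<theta>, t) + \<gamma>) $ i / snd (\<theta>, t) $ i))"
      using d2[of "s $ i / t $ i"] s[of i] t[of i] by (simp add: has_field_derivative_def s_def)
    from has_derivative_compose[OF div this] show ?thesis
      by (rule has_derivative_eq_rhs)
        (use t[of i] in \<open>simp add: fun_eq_iff field_simps power2_eq_square\<close>)
  qed
  then have "((\<lambda>z. \<chi> i. \<phi>' ((A *v fst z + \<gamma>) $ i / snd z $ i)) has_derivative (\<lambda>h. \<chi> i. ?f' h i)) (at (\<theta>, t))"
    by (intro has_derivative_vecI) simp
  from bounded_linear.has_derivative[OF matrix_vector_mul_bounded_linear this, of "transpose A"]
  show ?thesis
  proof (rule has_derivative_eq_rhs, intro ext)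
    fix h :: "(real^'k) \<times> (real^'m)"
    have "(\<chi> i. ?f' h i) = diag (\<chi> i. 1 / t $ i * \<phi>'' (s $ i / t $ i)) *v (A *v fst h)
        - diag (\<chi> i. s $ i / (t $ i)\<^sup>2 * \<phi>'' (s $ i / t $ i)) *v snd h"
      by (simp add: diag_mult_vec vec_eq_iff)
    then show "transpose A *v (\<chi> i. ?f' h i) =
        (transpose A ** diag (\<chi> i. 1 / t $ i * \<phi>'' (s $ i / t $ i)) ** A) *v fst h
         - (transpose A ** diag (\<chi> i. s $ i / (t $ i)\<^sup>2 * \<phi>'' (s $ i / t $ i))) *v snd h"
      by (simp only: matrix_vector_mult_diff_distrib matrix_vector_mul_assoc matrix_mul_assoc)
  qed
qed

theorem corollary31:
  fixes \<phi> :: "real \<Rightarrow> real"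
    and \<Theta> :: "(real^'k) set"
    and S :: "real^'k \<Rightarrow> real^'m"
    and M :: "(real^'m) set"
    and A :: "real^'k^'m"
    and \<gamma> :: "real^'m"
    and q :: "real^'m"
  assumes phi_convex: "convex_on {0..} \<phi>"
    and phi_cont_0: "continuous (at 0 within {0..}) \<phi>"
    and phi_strict: "strictly_convex_on {0<..} \<phi>"
    and phi_C2: "twice_continuously_differentiable_on \<phi> {0<..}"
    and k_le_m: "CARD('k) \<le> CARD('m)"
    and Theta_bounded: "bounded \<Theta>"
    and Theta_interior: "interior \<Theta> \<noteq> {}"
    and S_range: "S ` closure \<Theta> \<subseteq> closed_unit_cube"
    and S_cont: "continuous_on (closure \<Theta>) S"
    and S_inj: "inj_on S (closure \<Theta>)"
    and S_C2: "twice_continuously_differentiable_on S (interior \<Theta>)"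
    and S_interior: "S ` interior \<Theta> \<subseteq> open_unit_cube"
    and M_def: "M = S ` closure \<Theta>"
    and a: "\<And>w. w > 0 \<Longrightarrow> strongly_convex_on {0..1 / w} \<phi>"
    and b: "S ` interior \<Theta> = M \<inter> open_unit_cube"
    and c1: "convex (closure \<Theta>)"
    and c2: "\<And>\<theta>. \<theta> \<in> closure \<Theta> \<Longrightarrow> S \<theta> = A *v \<theta> + \<gamma>"
    and d: "filterlim (deriv \<phi>) at_bot (at_right 0)"
    and e1: "defined_by_linear_inequalities \<Theta>"
    and e2: "convex M"
    and e3: "M \<subseteq> prob_vectors"
    and q_prob: "q \<in> prob_vectors"
    and q_pos: "q \<in> open_unit_cube"
  defines "S' \<equiv> S_star \<phi> M"
    and "\<theta>' \<equiv> theta_star \<phi> \<Theta> S"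
  defines "B \<equiv> transpose A **
      diag (\<chi> i. 1 / q $ i * deriv (deriv \<phi>) (S (\<theta>' q) $ i / q $ i)) ** A"
    and "\<Delta> \<equiv> diag (\<chi> i. S (\<theta>' q) $ i / (q $ i)\<^sup>2 * deriv (deriv \<phi>) (S (\<theta>' q) $ i / q $ i))"
  shows "(\<exists>U. open U \<and> q \<in> U \<and> U \<subseteq> open_unit_cube \<and>
            (\<forall>t\<in>U.
               (\<exists>!s. is_phi_projection \<phi> M t s) \<and>
               (\<exists>!\<theta>. attains_inf (\<lambda>\<theta>. phi_divergence \<phi> (S \<theta>) t) (interior \<Theta>) \<theta>) \<and>
               (\<exists>!\<theta>. \<theta> \<in> interior \<Theta> \<and> S \<theta> = S' t) \<and>
               S (\<theta>' t) = S' t)) \<and>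
         continuously_differentiable_at \<theta>' q \<and>
         invertible B \<and>
         jacobian \<theta>' (at q) = matrix_inv B ** transpose A ** \<Delta> \<and>
         continuously_differentiable_at S' q \<and>
         jacobian S' (at q) = A ** jacobian \<theta>' (at q)"
proof -

  \<comment> \<open>Regularity of \<open>\<phi>\<close> and compactness of \<open>M\<close>\<close>
  \<comment> \<open>The whole open cube serves as the neighbourhood of \<open>q\<close>: the claims
    are proved at each of its points and specialised at the end.\<close>
  let ?P = "open_unit_cube :: (real^'m) set" and ?Q = "closed_unit_cube :: (real^'m) set"
  have open_P: "open ?P" by (rule open_open_unit_cube)
  note d12 = twice_continuously_differentiable_on_real[OF phi_C2 open_greaterThan]
  have d1: "(\<phi> has_real_derivative deriv \<phi> x) (at x)" if "x > 0" for x
    using d12(1) that by simp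
  have d2: "(deriv \<phi> has_real_derivative deriv (deriv \<phi>) x) (at x)" if "x > 0" for x
    using d12(2) that by simp
  \<comment> \<open>With \<open>w = 1 / (x + 1)\<close> strong convexity holds on
    \<open>{0..x + 1}\<close>, which has \<open>x\<close> in its interior.\<close>
  have d2_pos: "deriv (deriv \<phi>) x > 0" if "x > 0" for x
  proof (rule strongly_convex_on_deriv2_pos[OF a[of "1 / (x + 1)"]])
    show "(\<phi> has_real_derivative deriv \<phi> y) (at y)" if "y \<in> {0<..<x + 1}" for y
      using that d1 by simp
    show "(deriv \<phi> has_real_derivative deriv (deriv \<phi>) x) (at x)" using d2 that .
  qed (use that in auto)
  have phi_cont: "continuous_on {0..} \<phi>"
    unfolding continuous_on_eq_continuous_within
  proof
    fix x :: real assume "x \<in> {0..}"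
    then consider "x = 0" | "x > 0" by force
    then show "continuous (at x within {0..}) \<phi>"
      by cases (use phi_cont_0 d1 in \<open>auto intro: continuous_at_imp_continuous_at_within DERIV_isCont\<close>)
  qed
  have P_pos: "t $ i > 0" if "t \<in> ?P" for t i using that by (simp add: open_unit_cube_def)
  have P_ne: "t $ i \<noteq> 0" if "t \<in> ?P" for t i using P_pos[OF that, of i] by simp
  have MQ: "M \<subseteq> ?Q" using M_def S_range by simp
  have compM: "compact M"
    unfolding M_def by (intro compact_continuous_image S_cont) (simp add: Theta_bounded)
  \<comment> \<open>The image of \<open>\<theta>0\<close> is a point of \<open>M\<close> with all
    coordinates positive, the target of the perturbation below; a ball around
    \<open>\<theta>0\<close> later yields injectivity of \<open>A\<close>.\<close>
  obtain \<theta>0 where \<theta>0: "\<theta>0 \<in> interior \<Theta>" using Theta_interior by blast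
  have int_cl: "interior \<Theta> \<subseteq> closure \<Theta>" using interior_subset closure_subset by (rule subset_trans)
  have S0: "S \<theta>0 \<in> M" "S \<theta>0 \<in> ?P" using \<theta>0 b by auto
  have E_cont: "continuous_on (?P \<times> ?Q) (\<lambda>(t, s). phi_sum \<phi> s t)"
    by (rule continuous_on_phi_sum[OF phi_cont])
  have proj_iff: "is_phi_projection \<phi> M t s \<longleftrightarrow> s \<in> M \<and> (\<forall>y\<in>M. phi_sum \<phi> s t \<le> phi_sum \<phi> y t)"
    if "t \<in> ?P" for t s
    using phi_divergence_eq[OF that] by (simp add: is_phi_projection_def attains_inf_iff)

  \<comment> \<open>Existence, uniqueness and positivity of the projection\<close>
  have ex1: "\<exists>!s. is_phi_projection \<phi> M t s" if t: "t \<in> ?P" for t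
  proof -
    have "continuous_on M (\<lambda>s. (t, s))" by (intro continuous_intros)
    from continuous_on_compose2[OF E_cont this] have "continuous_on M (\<lambda>s. phi_sum \<phi> s t)"
      using t MQ by auto
    then obtain s where "s \<in> M" "\<forall>y\<in>M. phi_sum \<phi> s t \<le> phi_sum \<phi> y t"
      using continuous_attains_inf[OF compM] S0(1) by blast
    moreover have "s = s'" if s: "s \<in> M" "\<forall>y\<in>M. phi_sum \<phi> s t \<le> phi_sum \<phi> y t"
      and s': "s' \<in> M" "\<forall>y\<in>M. phi_sum \<phi> s' t \<le> phi_sum \<phi> y t" for s s'
    proof (rule ccontr)
      \<comment> \<open>The midpoint of two distinct minimisers lies in \<open>M\<close> and would
        do better than both.\<close>
      assume "s \<noteq> s'"
      then have "phi_sum \<phi> ((1/2) *\<^sub>R s + (1/2) *\<^sub>R s') t < (phi_sum \<phi> s t + phi_sum \<phi> s' t) / 2"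
        using s s' MQ by (intro phi_sum_midpoint_less a t) auto
      moreover have "(1/2) *\<^sub>R s + (1/2) *\<^sub>R s' \<in> M"
        using s s' by (intro convexD[OF e2]) auto
      ultimately show False using s s' by fastforce
    qed
    ultimately show ?thesis unfolding proj_iff[OF t] by blast
  qed
  have S'_proj: "is_phi_projection \<phi> M t (S' t)" if "t \<in> ?P" for t
    unfolding S'_def S_star_def by (rule theI'[OF ex1[OF that]])
  have S'_M: "S' t \<in> M" and S'_min: "\<And>y. y \<in> M \<Longrightarrow> phi_sum \<phi> (S' t) t \<le> phi_sum \<phi> y t"
    if "t \<in> ?P" for t
    using S'_proj[OF that] unfolding proj_iff[OF that] by auto
  have S'_unique: "(\<forall>y\<in>M. phi_sum \<phi> s t \<le> phi_sum \<phi> y t) \<longleftrightarrow> s = S' t" if "t \<in> ?P" "s \<in> M" for t s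
    using ex1[OF that(1)] S'_proj[OF that(1)] that(2) unfolding proj_iff[OF that(1)] by blast
  have S'_P: "S' t \<in> ?P" if t: "t \<in> ?P" for t
  proof -
    have Q: "S' t \<in> ?Q" and sum1: "(\<Sum>i\<in>UNIV. S' t $ i) = 1"
      using S'_M[OF t] e3 by (auto simp: prob_vectors_def)
    have pos: "S' t $ i > 0" for i
    proof (rule ccontr)
      assume "\<not> S' t $ i > 0"
      with Q have zero: "S' t $ i = 0" by (auto simp: closed_unit_cube_def not_less intro: antisym)
      \<comment> \<open>At a vanishing coordinate a short move towards \<open>S \<theta>0\<close>
        stays in the convex set \<open>M\<close> and lowers the sum.\<close>
      obtain \<epsilon> where \<epsilon>: "0 < \<epsilon>" "\<epsilon> < 1"
        "phi_sum \<phi> ((1 - \<epsilon>) *\<^sub>R S' t + \<epsilon> *\<^sub>R S \<theta>0) t < phi_sum \<phi> (S' t) t"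
        using phi_sum_less_from_boundary[OF phi_convex d1 d P_pos[OF t] _ zero P_pos[OF S0(2)]] Q
        by (auto simp: closed_unit_cube_def)
      have "(1 - \<epsilon>) *\<^sub>R S' t + \<epsilon> *\<^sub>R S \<theta>0 \<in> M"
        using \<epsilon> S'_M[OF t] S0(1) by (intro convexD[OF e2]) auto
      with S'_min[OF t] \<epsilon>(3) show False by fastforce
    qed
    have "S' t $ i < 1" for i
    proof -
      \<comment> \<open>Staying below 1 requires a second index to carry positive mass; it exists
        because \<open>S \<theta>0\<close> sums to 1 while its entry \<open>i\<close> is below
        1.\<close>
      have "(\<Sum>j\<in>UNIV. S \<theta>0 $ j) = 1" using S0(1) e3 by (auto simp: prob_vectors_def)
      then have "(\<Sum>j\<in>UNIV - {i}. S \<theta>0 $ j) = 1 - S \<theta>0 $ i"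
        by (simp add: sum.remove[of UNIV i])
      moreover have "S \<theta>0 $ i < 1" using S0(2) by (simp add: open_unit_cube_def)
      ultimately have "UNIV - {i} \<noteq> {}" by (metis diff_gt_0_iff_gt less_irrefl sum.empty)
      then have "(\<Sum>j\<in>UNIV - {i}. S' t $ j) > 0" using pos by (intro sum_pos) auto
      with sum1 show ?thesis by (simp add: sum.remove[of UNIV i])
    qed
    with pos show ?thesis by (simp add: open_unit_cube_def)
  qed

  \<comment> \<open>The parameter of the projection\<close>
  have \<theta>_ex1: "\<exists>!\<theta>. \<theta> \<in> interior \<Theta> \<and> S \<theta> = S' t" if "t \<in> ?P" for t
  proof -
    \<comment> \<open>Assumption \<open>b\<close> carries membership in the open cube back to the
      interior of \<open>\<Theta>\<close>.\<close>
    have "S' t \<in> S ` interior \<Theta>" unfolding b using S'_M[OF that] S'_P[OF that] by simp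
    then obtain \<theta> where \<theta>: "\<theta> \<in> interior \<Theta>" "S \<theta> = S' t" by auto
    moreover have "\<theta>1 = \<theta>" if "\<theta>1 \<in> interior \<Theta>" "S \<theta>1 = S' t" for \<theta>1
      using inj_onD[OF inj_on_subset[OF S_inj int_cl]] \<theta> that by simp
    ultimately show ?thesis by blast
  qed
  \<comment> \<open>The minimum over all of \<open>M\<close> is already attained at an interior
    parameter, so minimising over \<open>interior \<Theta>\<close> selects the same point; this
    links \<open>theta_star\<close> to \<open>S_star\<close>.\<close>
  have \<theta>_attains_iff: "attains_inf (\<lambda>\<theta>. phi_divergence \<phi> (S \<theta>) t) (interior \<Theta>) \<theta>
      \<longleftrightarrow> \<theta> \<in> interior \<Theta> \<and> S \<theta> = S' t" if t: "t \<in> ?P" for t \<theta>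
  proof -
    have SM: "S \<theta> \<in> M" if "\<theta> \<in> interior \<Theta>" for \<theta> using that b by blast
    obtain \<theta>1 where \<theta>1: "\<theta>1 \<in> interior \<Theta>" "S \<theta>1 = S' t" using \<theta>_ex1[OF t] by blast
    have "(\<forall>y\<in>interior \<Theta>. phi_sum \<phi> (S \<theta>) t \<le> phi_sum \<phi> (S y) t) \<longleftrightarrow> S \<theta> = S' t"
      if "\<theta> \<in> interior \<Theta>"
    proof
      assume "\<forall>y\<in>interior \<Theta>. phi_sum \<phi> (S \<theta>) t \<le> phi_sum \<phi> (S y) t"
      then have "phi_sum \<phi> (S \<theta>) t \<le> phi_sum \<phi> (S' t) t" using \<theta>1 by fastforce
      then show "S \<theta> = S' t"
        using S'_min[OF t] S'_unique[OF t SM[OF that]] by (meson order_trans)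
    qed (use S'_min[OF t] SM in auto)
    then show ?thesis by (auto simp: attains_inf_iff phi_divergence_eq[OF t])
  qed
  have \<theta>'_eq: "\<theta>' t = (THE \<theta>. \<theta> \<in> interior \<Theta> \<and> S \<theta> = S' t)" if "t \<in> ?P" for t
    unfolding \<theta>'_def theta_star_def \<theta>_attains_iff[OF that] ..
  have \<theta>'_int: "\<theta>' t \<in> interior \<Theta>" and S_\<theta>': "S (\<theta>' t) = S' t" if "t \<in> ?P" for t
    using theI'[OF \<theta>_ex1[OF that]] unfolding \<theta>'_eq[OF that] by auto
  have S'_affine: "S' t = A *v \<theta>' t + \<gamma>" if "t \<in> ?P" for t
    using c2 \<theta>'_int[OF that] S_\<theta>'[OF that] int_cl by (metis subsetD)

  \<comment> \<open>Injectivity of \<open>A\<close> and continuity of the minimisers\<close>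
  have A_inj: "v = 0" if "A *v v = 0" for v
  proof -
    obtain e where e: "e > 0" "ball \<theta>0 e \<subseteq> interior \<Theta>"
      using \<theta>0 open_interior open_contains_ball by blast
    \<comment> \<open>A multiple of a kernel vector short enough to stay in the ball moves
      \<open>\<theta>0\<close> without changing \<open>S\<close>. The summand 1 keeps the
      denominator positive when \<open>v = 0\<close>.\<close>
    define c where "c = e / 2 / (norm v + 1)"
    have nv: "norm v + 1 > 0" by (simp add: add_nonneg_pos)
    have c: "c > 0" using e(1) nv by (simp add: c_def)
    have "norm (c *\<^sub>R v) = c * norm v" using c by simp
    also have "\<dots> \<le> c * (norm v + 1)" using c by simp
    also have "\<dots> = e / 2"
      unfolding c_def using less_imp_neq[OF nv] by (intro nonzero_eq_divide_eq[THEN iffD1, OF _ refl]) simp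
    finally have "norm (c *\<^sub>R v) < e" using e(1) by simp
    then have "\<theta>0 + c *\<^sub>R v \<in> interior \<Theta>"
      using e(2) by (auto simp: dist_norm)
    then have in_cl: "\<theta>0 + c *\<^sub>R v \<in> closure \<Theta>" "\<theta>0 \<in> closure \<Theta>" using \<theta>0 int_cl by auto
    have "S (\<theta>0 + c *\<^sub>R v) = S \<theta>0"
      using that by (simp add: c2[OF in_cl(1)] c2[OF in_cl(2)] matrix_vector_right_distrib matrix_vector_mult_scaleR)
    then have "\<theta>0 + c *\<^sub>R v = \<theta>0" using S_inj in_cl by (meson inj_onD)
    then show "v = 0" using c by simp
  qed
  obtain L where L: "L ** A = mat 1"
    using A_inj matrix_left_invertible_ker[of A] by blast

  have S'_cont: "continuous_on ?P S'"
  proof (rule continuous_on_unique_argmin[OF compM, where E = "\<lambda>(t, s). phi_sum \<phi> s t"])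
    show "continuous_on (?P \<times> M) (\<lambda>(t, s). phi_sum \<phi> s t)"
      using E_cont MQ by (elim continuous_on_subset) auto
  qed (use S'_M S'_unique in auto)
  \<comment> \<open>Continuity of \<open>S'\<close> passes to the parameter through the left inverse
    of \<open>A\<close>.\<close>
  have "\<theta>' t = L *v (S' t - \<gamma>)" if "t \<in> ?P" for t
    using S'_affine[OF that] L by (simp add: matrix_vector_mul_assoc)
  moreover have "continuous_on ?P (\<lambda>t. L *v (S' t - \<gamma>))"
    by (intro bounded_linear.continuous_on[OF matrix_vector_mul_bounded_linear] continuous_intros S'_cont)
  ultimately have \<theta>'_cont: "continuous_on ?P \<theta>'" by (simp cong: continuous_on_cong)

  \<comment> \<open>The derivative of the parameter\<close>
  let ?F = "\<lambda>z. transpose A *v (\<chi> i. deriv \<phi> ((A *v fst z + \<gamma>) $ i / snd z $ i))"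
  \<comment> \<open>These are the second derivatives and the matrices of the statement with
    \<open>q\<close> replaced by \<open>t\<close>, since continuity of the Jacobian at
    \<open>q\<close> involves nearby points.\<close>
  define w where "w t i = deriv (deriv \<phi>) (S' t $ i / t $ i)" for t i
  define BB where "BB t = transpose A ** diag (\<chi> i. 1 / t $ i * w t i) ** A" for t
  define DD where "DD t = diag (\<chi> i. S' t $ i / (t $ i)\<^sup>2 * w t i)" for t
  have w_pos: "w t i > 0" if "t \<in> ?P" for t i
    unfolding w_def using P_pos[OF that] P_pos[OF S'_P[OF that]] by (intro d2_pos divide_pos_pos)
  have BB_inv: "invertible (BB t)" if "t \<in> ?P" for t
    unfolding BB_def using A_inj w_pos[OF that] P_pos[OF that]
    by (intro invertible_weighted_gram) auto
  have zero: "?F (\<theta>' t, t) = 0" if t: "t \<in> ?P" for t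
  proof -
    let ?v = "transpose A *v (\<chi> i. deriv \<phi> ((A *v \<theta>' t + \<gamma>) $ i / t $ i))"
    have "((\<lambda>\<theta>. phi_sum \<phi> (A *v \<theta> + \<gamma>) t) has_derivative (\<lambda>h. ?v \<bullet> h)) (at (\<theta>' t))"
      using S'_affine[OF t] P_pos[OF S'_P[OF t]]
      by (intro has_derivative_phi_sum_affine d1 P_pos[OF t]) auto
    moreover have "phi_sum \<phi> (A *v \<theta>' t + \<gamma>) t \<le> phi_sum \<phi> (A *v \<theta> + \<gamma>) t"
      if "\<theta> \<in> interior \<Theta>" for \<theta>
    proof -
      have "S \<theta> = A *v \<theta> + \<gamma>" "S \<theta> \<in> M" using that c2 int_cl b by auto
      then show ?thesis using S'_min[OF t, of "S \<theta>"] S'_affine[OF t] by simp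
    qed
    ultimately have "(\<lambda>h. ?v \<bullet> h) = (\<lambda>h. 0)"
      using differential_zero_maxmin[OF \<theta>'_int[OF t] open_interior] by blast
    \<comment> \<open>The derivative vanishes in every direction, in particular along
      \<open>?v\<close> itself.\<close>
    then have "?v \<bullet> ?v = 0" by (rule fun_cong)
    then show ?thesis by simp
  qed
  define J where "J t = matrix_inv (BB t) ** (transpose A ** DD t)" for t
  have \<theta>'_deriv: "(\<theta>' has_derivative (\<lambda>h. J t *v h)) (at t)" if t: "t \<in> ?P" for t
  proof -
    have "(?F has_derivative (\<lambda>h. BB t *v fst h - (transpose A ** DD t) *v snd h)) (at (\<theta>' t, t))"
      using has_derivative_score[of "deriv \<phi>" "deriv (deriv \<phi>)" t A "\<theta>' t" \<gamma>]
        d2 P_pos[OF t] P_pos[OF S'_P[OF t]]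
      unfolding BB_def DD_def w_def S'_affine[OF t, symmetric] by blast
    \<comment> \<open>The inverse of \<open>BB t\<close> undoes the first partial derivative. The
      second one already carries a minus sign, so the two signs cancel and leave
      \<open>J t\<close>.\<close>
    then have "(\<theta>' has_derivative (\<lambda>h. - (matrix_inv (BB t) *v
        (BB t *v fst (0, h) - (transpose A ** DD t) *v snd (0 :: real^'k, h))))) (at t)"
    proof (rule has_derivative_implicit)
      show "isCont \<theta>' t"
        using \<theta>'_cont t open_P by (simp add: continuous_on_eq_continuous_at)
      show "eventually (\<lambda>u. ?F (\<theta>' u, u) = 0) (nhds t)"
        using zero t open_P by (auto simp: eventually_nhds)
      show "bounded_linear ((*v) (matrix_inv (BB t)))"
        by (rule matrix_vector_mul_bounded_linear)
    qed (simp add: matrix_vector_mul_assoc matrix_inv_mult[OF BB_inv[OF t]])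
    then show ?thesis
      by (rule has_derivative_eq_rhs)
        (simp add: J_def linear_neg[OF matrix_vector_mul_linear] matrix_vector_mul_assoc fun_eq_iff)
  qed
  \<comment> \<open>Multiplying \<open>J t\<close> by \<open>BB t\<close> gives a linear system with
    continuous coefficients, to which Cramer's rule applies.\<close>
  have J_cont: "continuous_on ?P J"
  proof (rule continuous_on_matrix_solution[where B = BB and N = "\<lambda>t. transpose A ** DD t"])
    have "continuous_on ?P (\<lambda>t. w t i)" for i
      unfolding w_def
      by (rule continuous_on_compose2[OF d12(3)], intro continuous_intros S'_cont)
        (use P_pos P_pos[OF S'_P] in \<open>auto simp: P_ne intro!: divide_pos_pos\<close>)
    then have "continuous_on ?P (\<lambda>t. 1 / t $ i * w t i)"
      "continuous_on ?P (\<lambda>t. S' t $ i / (t $ i)\<^sup>2 * w t i)" for i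
      by (auto intro!: continuous_intros S'_cont simp: P_ne)
    note diag_cont = this
    have diag_cont': "continuous_on ?P (\<lambda>t. diag (\<chi> i. f t i) $ i $ j)"
      if "\<And>i. continuous_on ?P (\<lambda>t. f t i)" for f i j
      using that by (cases "i = j") (auto simp: diag_def)
    show "continuous_on ?P (\<lambda>t. BB t $ i $ j)" "continuous_on ?P (\<lambda>t. (transpose A ** DD t) $ i $ l)" for i j l
      unfolding BB_def DD_def matrix_matrix_mult_def vec_lambda_beta
      by (intro continuous_intros diag_cont' diag_cont)+
    show "det (BB t) \<noteq> 0" if "t \<in> ?P" for t
      using BB_inv[OF that] by (simp add: invertible_det_nz)
    show "BB t ** J t = transpose A ** DD t" if "t \<in> ?P" for t
      by (simp add: J_def matrix_mul_assoc matrix_inv_mult[OF BB_inv[OF that]])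
  qed

  \<comment> \<open>Continuous differentiability at \<open>q\<close>\<close>
  \<comment> \<open>The target dimension is arbitrary, so one argument serves both
    \<open>\<theta>'\<close> and \<open>S'\<close>.\<close>
  have C1: "continuously_differentiable_at g q \<and> jacobian g (at q) = G q"
    if g: "\<And>t. t \<in> ?P \<Longrightarrow> (g has_derivative (\<lambda>h. G t *v h)) (at t)" and G: "continuous_on ?P G"
    for g :: "real^'m \<Rightarrow> real^'n" and G
  proof -
    have jac: "jacobian g (at t) = G t" if "t \<in> ?P" for t
      using g[OF that] by (rule jacobian_eqI)
    have "continuous_on ?P (\<lambda>t. jacobian g (at t))"
      using G by (rule continuous_on_eq) (simp add: jac)
    then have "isCont (\<lambda>t. jacobian g (at t)) q"
      using q_pos open_P by (simp add: continuous_on_eq_continuous_at)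
    then show ?thesis
      using g jac q_pos open_P
      unfolding continuously_differentiable_at_def by (blast intro: differentiableI)
  qed
  have S'_deriv: "(S' has_derivative (\<lambda>h. (A ** J t) *v h)) (at t)" if t: "t \<in> ?P" for t
  proof -
    have "((\<lambda>t. A *v \<theta>' t + \<gamma>) has_derivative (\<lambda>h. A *v (J t *v h) + 0)) (at t)"
      by (intro has_derivative_add has_derivative_const
          bounded_linear.has_derivative[OF matrix_vector_mul_bounded_linear \<theta>'_deriv[OF t]])
    then show ?thesis
      using has_derivative_transform_within_open[OF _ open_P t] S'_affine
      by (fastforce simp: matrix_vector_mul_assoc)
  qed
  have AJ_cont: "continuous_on ?P (\<lambda>t. A ** J t)"
    unfolding matrix_matrix_mult_def by (intro continuous_intros J_cont)
  have C1_\<theta>': "continuously_differentiable_at \<theta>' q" "jacobian \<theta>' (at q) = J q"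
    using C1[OF \<theta>'_deriv J_cont] by auto
  have C1_S': "continuously_differentiable_at S' q" "jacobian S' (at q) = A ** J q"
    using C1[OF S'_deriv AJ_cont] by auto
  \<comment> \<open>The statement uses \<open>S (\<theta>' q)\<close> where the auxiliary matrices
    use \<open>S' q\<close>; both are the same point.\<close>
  have B_eq: "B = BB q" and \<Delta>_eq: "\<Delta> = DD q"
    unfolding B_def \<Delta>_def BB_def DD_def w_def S_\<theta>'[OF q_pos] by simp_all
  have "\<exists>!\<theta>. attains_inf (\<lambda>\<theta>. phi_divergence \<phi> (S \<theta>) t) (interior \<Theta>) \<theta>" if "t \<in> ?P" for t
    unfolding \<theta>_attains_iff[OF that] by (rule \<theta>_ex1[OF that])
  then have "\<exists>U. open U \<and> q \<in> U \<and> U \<subseteq> ?P \<and>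
      (\<forall>t\<in>U. (\<exists>!s. is_phi_projection \<phi> M t s) \<and>
         (\<exists>!\<theta>. attains_inf (\<lambda>\<theta>. phi_divergence \<phi> (S \<theta>) t) (interior \<Theta>) \<theta>) \<and>
         (\<exists>!\<theta>. \<theta> \<in> interior \<Theta> \<and> S \<theta> = S' t) \<and> S (\<theta>' t) = S' t)"
    by (intro exI[of _ ?P] conjI ballI ex1 \<theta>_ex1 S_\<theta>' open_P q_pos order_refl)
  moreover have "jacobian \<theta>' (at q) = matrix_inv B ** transpose A ** \<Delta>"
    by (simp add: C1_\<theta>' J_def B_eq \<Delta>_eq matrix_mul_assoc)
  ultimately show ?thesis
    using C1_\<theta>' C1_S' BB_inv[OF q_pos] B_eq by simp
qed

end
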